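(* There exist graphs $G$ for which the minimum quasiperiod of the quasipolynomial $M_G$ is arbitrarily large. In particular, for each integer $n \ge 2$ there exists a graph $G_n$ with $2n+2$ vertices and $3n$ edges such that the polytope $P_{G_n}$ has a vertex with denominator $n-1$, and the minimum quasiperiod of the quasipolynomial $M_{G_n}$ is $n-1$.
   Context: A graph $G=(V,E)$ is finite, undirected, without multiple edges (but possibly with loops). For $L \in \mathbb{R}^E$ and $v\in V$ put $s_L(v) = \sum_{e \in E,\, e \ni v} L(e)$. Define the cone $C_G = \{L \in \mathbb{R}_{\ge 0}^E : s_L(v) = s_L(w) \text{ for all } v,w \in V\}$ and the rational polytope $P_G = C_G \cap [0,1]^E$. A magic labeling of $G$ is an element of $C_G \cap \mathbb{Z}^E$, i.e. a labeling of the edges by nonnegative integers with the same label sum at every vertex. For $k \in \mathbb{Z}_{\ge 0}$, let $M_G(k) = |kP_G \cap \mathbb{Z}^E|$, where $kP_G=\{kL : L\in P_G\}$; this is the number of magic labelings of $G$ with all labels at most $k$, and it is a quasipolynomial in $k$ (it is the Ehrhart quasipolynomial of $P_G$). A function $F$ from $\mathbb{Z}$ or $\mathbb{Z}_{\ge 0}$ to $\mathbb{C}$ is a quasipolynomial if there exist an integer $s \ge 1$ and polynomials $\phi_1,\dots,\phi_s \in \mathbb{C}[x]$ such that $F(t) = \phi_r(t)$ whenever $t \equiv r \pmod s$; such an $s$ is called a quasiperiod of $F$, and the minimum quasiperiod is the least such $s$. The denominator of a rational point $v$ is the least integer $t \ge 1$ such that $tv$ has integer coordinates. *)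

theory Defs
  imports
    "HOL-Analysis.Analysis"
    "HOL-Analysis.Finite_Function_Topology"
    "HOL-Computational_Algebra.Polynomial"
begin

(* An edge is the set of its endpoints, so that a loop at v is the singleton {v}. *)
definition graph :: "'a set \<Rightarrow> 'a set set \<Rightarrow> bool" where
  "graph V E \<longleftrightarrow> finite V \<and> (\<forall>e\<in>E. e \<subseteq> V \<and> (card e = 1 \<or> card e = 2))"

(* For finite E, the space of real vectors indexed by E is the subspace of those finitely
   supported functions on all sets of vertices whose support (keys) lies in E.  This makes the
   real_vector structure, and with it extreme_point_of, available for a varying edge set E. *)
type_synonym 'a labeling = "'a set \<Rightarrow>\<^sub>0 real"

(* A loop at v is counted once in the sum at v. *)
definition vertex_sum :: "'a set set \<Rightarrow> 'a labeling \<Rightarrow> 'a \<Rightarrow> real" where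
  "vertex_sum E L v = (\<Sum>e\<in>{e\<in>E. v \<in> e}. Poly_Mapping.lookup L e)"

definition magic_cone :: "'a set \<Rightarrow> 'a set set \<Rightarrow> 'a labeling set" where
  "magic_cone V E = {L. Poly_Mapping.keys L \<subseteq> E \<and> (\<forall>e\<in>E. 0 \<le> Poly_Mapping.lookup L e)
     \<and> (\<forall>v\<in>V. \<forall>w\<in>V. vertex_sum E L v = vertex_sum E L w)}"

definition magic_polytope :: "'a set \<Rightarrow> 'a set set \<Rightarrow> 'a labeling set" where
  "magic_polytope V E =
     magic_cone V E \<inter> {L. \<forall>e\<in>E. 0 \<le> Poly_Mapping.lookup L e \<and> Poly_Mapping.lookup L e \<le> 1}"

definition integral_point :: "('b \<Rightarrow>\<^sub>0 real) \<Rightarrow> bool" where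
  "integral_point x \<longleftrightarrow> (\<forall>i. Poly_Mapping.lookup x i \<in> \<int>)"

definition rational_point :: "('b \<Rightarrow>\<^sub>0 real) \<Rightarrow> bool" where
  "rational_point x \<longleftrightarrow> (\<forall>i. Poly_Mapping.lookup x i \<in> \<rat>)"

(* Meaningful only for rational points. *)
definition denominator :: "('b \<Rightarrow>\<^sub>0 real) \<Rightarrow> nat" where
  "denominator x = (LEAST t. 1 \<le> t \<and> integral_point (real t *\<^sub>R x))"

definition magic_count :: "'a set \<Rightarrow> 'a set set \<Rightarrow> nat \<Rightarrow> nat" where
  "magic_count V E k =
     card {L \<in> (\<lambda>L. real k *\<^sub>R L) ` magic_polytope V E. integral_point L}"

definition quasiperiod :: "(nat \<Rightarrow> complex) \<Rightarrow> nat \<Rightarrow> bool" where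
  "quasiperiod F s \<longleftrightarrow> 1 \<le> s \<and>
     (\<exists>\<phi> :: nat \<Rightarrow> complex poly. \<forall>r\<in>{1..s}. \<forall>t. t mod s = r mod s \<longrightarrow> F t = poly (\<phi> r) (of_nat t))"

definition quasipolynomial :: "(nat \<Rightarrow> complex) \<Rightarrow> bool" where
  "quasipolynomial F \<longleftrightarrow> (\<exists>s. quasiperiod F s)"

(* Meaningful only for quasipolynomials. *)
definition min_quasiperiod :: "(nat \<Rightarrow> complex) \<Rightarrow> nat" where
  "min_quasiperiod F = (LEAST s. quasiperiod F s)"

end

(* G_n consists of two hubs joined by n internally disjoint paths of length 3. A magic labeling is
   determined by the labels y_1, ..., y_n at the first hub: with s = y_1 + ... + y_n, the i-th path
   carries y_i, s - y_i, y_i. Put m = n - 1. All labels are at most k iff s <= k + y_i for all i;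
   either s <= k, or s = k + t with t >= 1, and then y_i = t + u_i with u_i >= 0 arbitrary subject to
   u_1 + ... + u_n = k - m t. Hence
     M(k) = binom(k+n, n) + sum_{1 <= t <= k/m} binom(k-mt+m, m),
   which has quasiperiod m. Taking m successive differences of the sum leaves floor(k/m), and one
   more leaves the indicator of m | k+1, up to a shift of k; differences preserve quasiperiods, so
   m divides every quasiperiod. The constant labeling y_i = 1/m is the vertex with denominator m. *)
theory Submission
  imports Defs
begin

section \<open>Quasiperiods\<close>

lemma poly_binomial_shift:
  "\<exists>p :: 'a::field_char_0 poly. \<forall>k. of_nat (k + e choose e) = poly p (of_nat k)"
proof (intro exI allI)
  fix k
  have "(of_nat (k + e choose e) :: 'a) = pochhammer (of_nat k + 1) e / fact e"
    by (simp add: binomial_gbinomial gbinomial_pochhammer')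
  also have "\<dots> = poly (smult (1 / fact e) (\<Prod>i<e. [:1 + of_nat i, 1:])) (of_nat k)"
    by (simp add: pochhammer_prod poly_prod atLeast0LessThan algebra_simps)
  finally show "(of_nat (k + e choose e) :: 'a)
    = poly (smult (1 / fact e) (\<Prod>i<e. [:1 + of_nat i, 1:])) (of_nat k)" .
qed

text \<open>Telescoping \<open>(i+1)^(e+1) - i^(e+1)\<close> over \<open>i < q\<close> gives
  \<open>q^(e+1)\<close>. By the binomial theorem each difference is a combination of the powers
  \<open>i^j\<close> with \<open>j \<le> e\<close>, so the \<open>e\<close>-th power sum can be
  solved for in terms of all lower ones. This is why the induction is strong.\<close>

lemma power_sum_polynomial:
  "\<exists>Q :: 'a::field_char_0 poly. \<forall>q. (\<Sum>i<q. of_nat i ^ e) = poly Q (of_nat q)"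
proof (induction e rule: less_induct)
  case (less e)
  then obtain S :: "nat \<Rightarrow> 'a poly"
    where S: "\<And>j q. j < e \<Longrightarrow> (\<Sum>i<q. of_nat i ^ j) = poly (S j) (of_nat q)"
    by metis
  let ?Q = "smult (1 / of_nat (Suc e))
              (monom 1 (Suc e) - (\<Sum>j<e. smult (of_nat (Suc e choose j)) (S j)))"
  have "(\<Sum>i<q. of_nat i ^ e) = poly ?Q (of_nat q)" for q
  proof -
    have "(of_nat q :: 'a) ^ Suc e = (\<Sum>i<q. of_nat (Suc i) ^ Suc e - of_nat i ^ Suc e)"
      by (subst sum_lessThan_telescope) simp
    also have "\<dots> = (\<Sum>i<q. \<Sum>j\<le>e. of_nat (Suc e choose j) * of_nat i ^ j)"
    proof (intro sum.cong refl)
      fix i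
      have "(of_nat (Suc i) :: 'a) ^ Suc e = (of_nat i + 1) ^ Suc e"
        by (simp add: add.commute)
      also have "\<dots> = (\<Sum>j\<le>Suc e. of_nat (Suc e choose j) * of_nat i ^ j)"
        by (subst binomial_ring) simp
      finally show "(of_nat (Suc i) :: 'a) ^ Suc e - of_nat i ^ Suc e
          = (\<Sum>j\<le>e. of_nat (Suc e choose j) * of_nat i ^ j)"
        by simp
    qed
    also have "\<dots> = (\<Sum>j\<le>e. of_nat (Suc e choose j) * (\<Sum>i<q. of_nat i ^ j))"
      by (subst sum.swap) (simp add: sum_distrib_left)
    also have "\<dots> = (\<Sum>j<e. of_nat (Suc e choose j) * poly (S j) (of_nat q))
                      + of_nat (Suc e) * (\<Sum>i<q. of_nat i ^ e)"
      by (simp add: lessThan_Suc_atMost[symmetric] S)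
    finally have "of_nat (Suc e) * (\<Sum>i<q. of_nat i ^ e)
        = (of_nat q :: 'a) ^ Suc e - (\<Sum>j<e. of_nat (Suc e choose j) * poly (S j) (of_nat q))"
      by (simp add: algebra_simps)
    then have "(\<Sum>i<q. of_nat i ^ e) = 1 / of_nat (Suc e) * ((of_nat q :: 'a) ^ Suc e
        - (\<Sum>j<e. of_nat (Suc e choose j) * poly (S j) (of_nat q)))"
      by (simp add: field_simps del: of_nat_Suc)
    then show ?thesis
      by (simp add: poly_sum poly_monom del: of_nat_Suc)
  qed
  then show ?case
    by blast
qed

lemma poly_sum_polynomial:
  fixes p :: "'a::field_char_0 poly"
  shows "\<exists>Q. \<forall>q. (\<Sum>i<q. poly p (of_nat i)) = poly Q (of_nat q)"
proof -
  obtain S :: "nat \<Rightarrow> 'a poly" where S: "\<And>e q. (\<Sum>i<q. of_nat i ^ e) = poly (S e) (of_nat q)"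
    using power_sum_polynomial by metis
  have "(\<Sum>i<q. poly p (of_nat i)) = poly (\<Sum>e\<le>degree p. smult (coeff p e) (S e)) (of_nat q)" for q
  proof -
    have "(\<Sum>i<q. poly p (of_nat i)) = (\<Sum>e\<le>degree p. \<Sum>i<q. coeff p e * of_nat i ^ e)"
      by (subst sum.swap) (simp add: poly_altdef)
    then show ?thesis
      by (simp add: poly_sum sum_distrib_left[symmetric] S)
  qed
  then show ?thesis
    by blast
qed

text \<open>Allowing every natural \<open>r\<close> as a representative of its residue class makes
  shifts such as \<open>Suc r\<close> available without first reducing them to
  \<open>{1..s}\<close>.\<close>

lemma quasiperiod_iff:
  "quasiperiod F s \<longleftrightarrow>
     1 \<le> s \<and> (\<forall>r. \<exists>p. \<forall>t. t mod s = r mod s \<longrightarrow> F t = poly p (of_nat t))"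
proof
  assume F: "quasiperiod F s"
  then obtain \<phi> where s: "1 \<le> s"
    and \<phi>: "\<And>r t. r \<in> {1..s} \<Longrightarrow> t mod s = r mod s \<Longrightarrow> F t = poly (\<phi> r) (of_nat t)"
    unfolding quasiperiod_def by blast
  have "\<exists>p. \<forall>t. t mod s = r mod s \<longrightarrow> F t = poly p (of_nat t)" for r
  proof -
    \<comment> \<open>The definition lets \<open>r\<close> range over \<open>{1..s}\<close>, so
      residue 0 is represented by \<open>s\<close>.\<close>
    define r' where "r' = (if r mod s = 0 then s else r mod s)"
    have "r' \<in> {1..s}" "r' mod s = r mod s"
      using s by (auto simp: r'_def Suc_le_eq less_imp_le)
    with \<phi>[of r'] show ?thesis
      by auto
  qed
  with s show "1 \<le> s \<and> (\<forall>r. \<exists>p. \<forall>t. t mod s = r mod s \<longrightarrow> F t = poly p (of_nat t))"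
    by blast
next
  assume s: "1 \<le> s \<and> (\<forall>r. \<exists>p. \<forall>t. t mod s = r mod s \<longrightarrow> F t = poly p (of_nat t))"
  then obtain \<phi> where "\<forall>r. \<forall>t. t mod s = r mod s \<longrightarrow> F t = poly (\<phi> r) (of_nat t)"
    using choice[of "\<lambda>r p. \<forall>t. t mod s = r mod s \<longrightarrow> F t = poly p (of_nat t)"] by blast
  with s show "quasiperiod F s"
    unfolding quasiperiod_def by blast
qed

section \<open>Closure properties of quasiperiods\<close>

lemma quasiperiod_poly: "1 \<le> s \<Longrightarrow> quasiperiod (\<lambda>k. poly p (of_nat k)) s"
  unfolding quasiperiod_iff by blast

lemma quasiperiod_diff:
  assumes "quasiperiod F s" "quasiperiod G s"
  shows "quasiperiod (\<lambda>k. F k - G k) s"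
  unfolding quasiperiod_iff
proof (intro conjI allI)
  show "1 \<le> s"
    using assms by (simp add: quasiperiod_iff)
  fix r
  obtain p q where "\<And>t. t mod s = r mod s \<Longrightarrow> F t = poly p (of_nat t)"
    and "\<And>t. t mod s = r mod s \<Longrightarrow> G t = poly q (of_nat t)"
    using assms unfolding quasiperiod_iff by blast
  then show "\<exists>p. \<forall>t. t mod s = r mod s \<longrightarrow> F t - G t = poly p (of_nat t)"
    by (intro exI[of _ "p - q"]) simp
qed

lemma quasiperiod_add:
  assumes "quasiperiod F s" "quasiperiod G s"
  shows "quasiperiod (\<lambda>k. F k + G k) s"
  unfolding quasiperiod_iff
proof (intro conjI allI)
  show "1 \<le> s"
    using assms by (simp add: quasiperiod_iff)
  fix r
  obtain p q where "\<And>t. t mod s = r mod s \<Longrightarrow> F t = poly p (of_nat t)"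
    and "\<And>t. t mod s = r mod s \<Longrightarrow> G t = poly q (of_nat t)"
    using assms unfolding quasiperiod_iff by blast
  then show "\<exists>p. \<forall>t. t mod s = r mod s \<longrightarrow> F t + G t = poly p (of_nat t)"
    by (intro exI[of _ "p + q"]) simp
qed

lemma quasiperiod_Suc:
  assumes "quasiperiod F s"
  shows "quasiperiod (\<lambda>k. F (Suc k)) s"
  unfolding quasiperiod_iff
proof (intro conjI allI)
  show "1 \<le> s"
    using assms by (simp add: quasiperiod_iff)
  fix r
  obtain p where p: "\<And>t. t mod s = Suc r mod s \<Longrightarrow> F t = poly p (of_nat t)"
    using assms unfolding quasiperiod_iff by blast
  have "F (Suc t) = poly (p \<circ>\<^sub>p [:1, 1:]) (of_nat t)" if "t mod s = r mod s" for t
    using p[of "Suc t"] that mod_Suc_eq[of t s] mod_Suc_eq[of r s] by (simp add: poly_pcompose)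
  then show "\<exists>p. \<forall>t. t mod s = r mod s \<longrightarrow> F (Suc t) = poly p (of_nat t)"
    by blast
qed

text \<open>The count needs only \<open>e = m\<close>; the separate parameter \<open>e\<close>
  allows induction, since differencing in \<open>k\<close> lowers \<open>e\<close> and keeps
  \<open>m\<close>. The range of \<open>t\<close> ensures that \<open>k - m * t\<close> is never
  truncated.\<close>

definition step_binomial_sum :: "nat \<Rightarrow> nat \<Rightarrow> nat \<Rightarrow> nat" where
  "step_binomial_sum m e k = (\<Sum>t=1..k div m. k - m * t + e choose e)"

text \<open>On the class \<open>k = \<rho> + m * q\<close> the substitution \<open>i = q - t\<close>
  turns the summands into values of a fixed polynomial at \<open>i < q\<close>. Their sum is a
  polynomial in \<open>q\<close>, hence in \<open>k\<close>, because
  \<open>q = (k - \<rho>) / m\<close>.\<close>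

lemma quasiperiod_step_binomial_sum:
  assumes m: "1 \<le> m"
  shows "quasiperiod (\<lambda>k. of_nat (step_binomial_sum m e k)) m"
  unfolding quasiperiod_iff
proof (intro conjI allI)
  fix r
  define \<rho> where "\<rho> = r mod m"
  obtain p :: "complex poly" where p: "\<And>k. of_nat (k + e choose e) = poly p (of_nat k)"
    using poly_binomial_shift by metis
  obtain Q where Q: "\<And>q. (\<Sum>i<q. poly (p \<circ>\<^sub>p [:of_nat \<rho>, of_nat m:]) (of_nat i)) = poly Q (of_nat q)"
    using poly_sum_polynomial by metis
  have "of_nat (step_binomial_sum m e k)
      = poly (Q \<circ>\<^sub>p [:- of_nat \<rho> / of_nat m, 1 / of_nat m:]) (of_nat k)"
    if "k mod m = r mod m" for k
  proof -
    define q where "q = k div m"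
    have k: "k = \<rho> + m * q"
      using that by (simp add: \<rho>_def q_def flip: that)
    have "step_binomial_sum m e k = (\<Sum>i<q. \<rho> + m * i + e choose e)"
      unfolding step_binomial_sum_def q_def[symmetric]
    proof (rule sum.reindex_bij_witness[of _ "\<lambda>i. q - i" "\<lambda>t. q - t"])
      fix t assume t: "t \<in> {1..q}"
      then have "k - m * t = \<rho> + m * (q - t)"
        using mult_le_mono2[of t q m] by (simp add: k diff_mult_distrib2)
      then show "\<rho> + m * (q - t) + e choose e = k - m * t + e choose e"
        by simp
    qed auto
    then have "of_nat (step_binomial_sum m e k) = poly Q (of_nat q)"
      by (simp add: p poly_pcompose mult.commute flip: Q)
    moreover have "of_nat q = (of_nat k - of_nat \<rho>) / (of_nat m :: complex)"
      using m by (simp add: k)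
    ultimately show ?thesis
      by (simp add: poly_pcompose diff_divide_distrib)
  qed
  then show "\<exists>p. \<forall>t. t mod m = r mod m \<longrightarrow> 
      of_nat (step_binomial_sum m e t) = poly p (of_nat t :: complex)"
    by blast
qed (use m in simp)

text \<open>This is Pascal's rule summand by summand. The range of \<open>t\<close> grows only if
  \<open>m\<close> divides \<open>Suc k\<close>.\<close>

lemma step_binomial_sum_Suc_diff:
  assumes m: "1 \<le> m"
  shows "step_binomial_sum m (Suc e) (Suc k)
    = step_binomial_sum m (Suc e) k + step_binomial_sum m e (Suc k)"
proof -
  have pascal: "Suc k - m * t + Suc e choose Suc e
      = (k - m * t + Suc e choose Suc e) + (Suc k - m * t + e choose e)"
    if "t \<in> {1..k div m}" for t
  proof -
    have "m * t \<le> m * (k div m)"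
      using that by (intro mult_le_mono2) simp
    then have "m * t \<le> k"
      using times_div_less_eq_dividend[of m k] by linarith
    then show ?thesis
      by (simp add: Suc_diff_le)
  qed
  then have pascal_sum: "(\<Sum>t=1..k div m. Suc k - m * t + Suc e choose Suc e)
      = (\<Sum>t=1..k div m. k - m * t + Suc e choose Suc e)
        + (\<Sum>t=1..k div m. Suc k - m * t + e choose e)"
    by (simp only: sum.distrib[symmetric] cong: sum.cong)
  show ?thesis
  proof (cases "Suc k mod m = 0")
    case True
    \<comment> \<open>The additional summand has upper part 0, so it contributes 1 to both sums
      taken at \<open>Suc k\<close>.\<close>
    then have top: "Suc k - m * Suc (k div m) = 0"
      by (metis div_Suc mult_div_mod_eq add_0_right diff_self_eq_0)
    have "Suc k div m = Suc (k div m)"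
      using True by (simp add: div_Suc)
    then show ?thesis
      unfolding step_binomial_sum_def by (simp only: sum.cl_ivl_Suc pascal_sum top) simp
  next
    case False
    then have "Suc k div m = k div m"
      by (simp add: div_Suc)
    then show ?thesis
      unfolding step_binomial_sum_def by (simp only: pascal_sum)
  qed
qed

text \<open>Let \<open>m\<close> divide \<open>k0 + j\<close>. The polynomial for the class of
  \<open>k0\<close> modulo \<open>s\<close> takes the value 1 at the infinitely many points
  \<open>k0 + s * (m * i)\<close>, so it is constantly 1. The indicator is therefore 1 at
  \<open>k0 + s\<close> as well, which forces \<open>m\<close> to divide \<open>s\<close>.\<close>

lemma dvd_quasiperiod_indicator:
  assumes s: "quasiperiod (\<lambda>k. if m dvd k + j then 1 else 0) s" and m: "1 \<le> m"
  shows "m dvd s"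
proof -
  \<comment> \<open>The choice \<open>k0 = m * j - j\<close> makes \<open>k0 + j\<close> equal to
    \<open>m * j\<close>; the subtraction is exact because \<open>m \<ge> 1\<close>.\<close>
  have "m dvd m * j - j + j"
  proof -
    have "m * j - j + j = m * j"
      using m by simp
    then show ?thesis
      by simp
  qed
  moreover define k0 where "k0 = m * j - j"
  ultimately have k0: "m dvd k0 + j"
    by simp
  obtain p :: "complex poly" where p: "\<And>t. t mod s = k0 mod s \<Longrightarrow> (if m dvd t + j then 1 else 0) = poly p (of_nat t)"
    using s unfolding quasiperiod_iff by blast
  have "poly p (of_nat (k0 + s * (m * i))) = 1" for i
  proof -
    have "k0 + s * (m * i) + j = (k0 + j) + m * (s * i)"
      by simp
    then have "m dvd k0 + s * (m * i) + j"
      using k0 by (metis dvd_add dvd_triv_left)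
    then show ?thesis
      using p[of "k0 + s * (m * i)"] by simp
  qed
  then have sub: "range (\<lambda>i. of_nat (k0 + s * (m * i))) \<subseteq> {x. poly (p - 1) x = 0}"
    by auto
  have "inj (\<lambda>i. of_nat (k0 + s * (m * i)) :: complex)"
    using s m by (auto simp: inj_on_def quasiperiod_iff simp del: of_nat_add of_nat_mult)
  then have "infinite (range (\<lambda>i. of_nat (k0 + s * (m * i)) :: complex))"
    by (rule range_inj_infinite)
  then have "infinite {x. poly (p - 1) x = 0}"
    using sub infinite_super by blast
  then have "p = 1"
    using poly_roots_finite[of "p - 1"] by auto
  with p[of "k0 + s"] have "m dvd (k0 + j) + s"
    by (simp add: ac_simps split: if_splits)
  with k0 show ?thesis
    by (simp only: dvd_add_right_iff)
qed

text \<open>A forward difference keeps the quasiperiod \<open>s\<close>, lowers \<open>e\<close> by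
  one and raises the shift \<open>j\<close> by one; hence \<open>j\<close> is arbitrary in the
  induction. At \<open>e = 0\<close> the sum is the floor of \<open>(k + j) / m\<close>, whose
  difference is the indicator of \<open>m dvd k + Suc j\<close>.\<close>

lemma dvd_quasiperiod_step_binomial_sum:
  assumes "quasiperiod (\<lambda>k. of_nat (step_binomial_sum m e (k + j))) s" and m: "1 \<le> m"
  shows "m dvd s"
  using assms(1)
proof (induction e arbitrary: j)
  case 0
  have "quasiperiod (\<lambda>k. of_nat (step_binomial_sum m 0 (Suc k + j))
      - of_nat (step_binomial_sum m 0 (k + j))) s"
    using quasiperiod_diff[OF quasiperiod_Suc[OF 0] 0] by simp
  also have "(\<lambda>k. of_nat (step_binomial_sum m 0 (Suc k + j)) - of_nat (step_binomial_sum m 0 (k + j)))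
      = (\<lambda>k. if m dvd k + Suc j then 1 else (0::complex))"
    by (rule ext) (auto simp: step_binomial_sum_def div_Suc dvd_eq_mod_eq_0)
  finally show ?case
    using dvd_quasiperiod_indicator m by blast
next
  case (Suc e)
  have "quasiperiod (\<lambda>k. of_nat (step_binomial_sum m (Suc e) (Suc k + j))
      - of_nat (step_binomial_sum m (Suc e) (k + j))) s"
    using quasiperiod_diff[OF quasiperiod_Suc[OF Suc.prems] Suc.prems] by simp
  also have "(\<lambda>k. of_nat (step_binomial_sum m (Suc e) (Suc k + j))
        - of_nat (step_binomial_sum m (Suc e) (k + j)))
      = (\<lambda>k. of_nat (step_binomial_sum m e (k + Suc j)) :: complex)"
    by (rule ext) (simp add: step_binomial_sum_Suc_diff[OF m])
  finally show ?case
    by (rule Suc.IH)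
qed

text \<open>The binomial term is a polynomial and so has every quasiperiod \<open>s \<ge> 1\<close>.
  Subtracting it from \<open>F\<close> leaves the step sum, all of whose quasiperiods are multiples
  of \<open>m\<close>.\<close>

lemma quasiperiod_binomial_plus_step_binomial_sum:
  fixes m e :: nat
  defines "F \<equiv> \<lambda>k. of_nat ((k + Suc e choose Suc e) + step_binomial_sum m e k)"
  assumes m: "1 \<le> m"
  shows "quasiperiod F m" "min_quasiperiod F = m"
proof -
  obtain p :: "complex poly" where p: "\<And>k. of_nat (k + Suc e choose Suc e) = poly p (of_nat k)"
    using poly_binomial_shift by metis
  have F: "F = (\<lambda>k. poly p (of_nat k) + of_nat (step_binomial_sum m e k))"
    unfolding F_def by (simp only: of_nat_add p)
  show "quasiperiod F m"
    unfolding F by (intro quasiperiod_add quasiperiod_poly quasiperiod_step_binomial_sum m)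
  moreover have "m \<le> s" if s: "quasiperiod F s" for s
  proof -
    have "1 \<le> s"
      using s by (simp add: quasiperiod_iff)
    from quasiperiod_diff[OF s quasiperiod_poly[OF this, of p]]
    have "quasiperiod (\<lambda>k. of_nat (step_binomial_sum m e (k + 0))) s"
      by (simp add: F)
    then have "m dvd s"
      using m by (rule dvd_quasiperiod_step_binomial_sum)
    with \<open>1 \<le> s\<close> show ?thesis
      by (simp add: dvd_imp_le)
  qed
  ultimately show "min_quasiperiod F = m"
    unfolding min_quasiperiod_def by (rule Least_equality)
qed

section \<open>Counting\<close>

text \<open>Sorting the lists by their exact sum \<open>j\<close>, stars and bars counts each layer
  and the hockey-stick identity adds the layers up.\<close>

lemma card_lists_sum_le:
  "finite {y :: nat list. length y = Suc m \<and> sum_list y \<le> k}" (is ?fin)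
  "card {y :: nat list. length y = Suc m \<and> sum_list y \<le> k} = (k + Suc m choose Suc m)" (is ?card)
proof -
  have fin: "finite {y :: nat list. length y = Suc m \<and> sum_list y = j}" for j
    by (rule finite_subset[OF _ finite_lists_length_eq[of "{..j}" "Suc m"]])
       (auto dest: member_le_sum_list)
  have U: "{y :: nat list. length y = Suc m \<and> sum_list y \<le> k}
      = (\<Union>j\<in>{..k}. {y. length y = Suc m \<and> sum_list y = j})"
    by auto
  show ?fin
    unfolding U using fin by blast
  have "card {y :: nat list. length y = Suc m \<and> sum_list y \<le> k}
      = (\<Sum>j\<le>k. card {y :: nat list. length y = Suc m \<and> sum_list y = j})"
    unfolding U using fin by (intro card_UN_disjoint) auto
  also have "\<dots> = (\<Sum>j\<le>k. m + j choose j)"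
    by (simp add: card_length_sum_list add.commute)
  also have "\<dots> = (k + Suc m choose Suc m)"
    by (subst sum_choose_lower, subst binomial_symmetric) (simp_all add: add.commute)
  finally show ?card .
qed

text \<open>The lists are sorted by the excess \<open>t\<close> of their sum over \<open>k\<close>.
  If \<open>t \<ge> 1\<close>, the condition says that every entry is at least \<open>t\<close>;
  removing \<open>t\<close> from each of the \<open>m + 1\<close> entries leaves a list with sum
  \<open>k + t - (m + 1) * t = k - m * t\<close>.\<close>

lemma card_lists_sum_le_add_nth:
  assumes m: "1 \<le> m"
  shows "card {y :: nat list. length y = Suc m \<and> (\<forall>i<Suc m. sum_list y \<le> k + y ! i)}
    = (k + Suc m choose Suc m) + step_binomial_sum m m k"
proof -
  define A where "A = {y :: nat list. length y = Suc m \<and> sum_list y \<le> k}"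
  define U where "U t = {u :: nat list. length u = Suc m \<and> sum_list u = k - m * t}" for t
  define B where "B t = map ((+) t) ` U t" for t
  have sum_shift: "sum_list (map ((+) t) u) = Suc m * t + sum_list u"
    if "length u = Suc m" for t and u :: "nat list"
    using sum_list_addf[of "\<lambda>_. t" "\<lambda>x. x" u] that by (simp add: sum_list_triv)
  \<comment> \<open>The excess can be read off from the sum, so the sets \<open>B t\<close> are
    disjoint from each other and from \<open>A\<close>.\<close>
  have sum_B: "sum_list y = k + t" if "y \<in> B t" "t \<in> {1..k div m}" for y t
  proof -
    have "t * m \<le> k"
      using that m by (simp add: less_eq_div_iff_mult_less_eq)
    with that show ?thesis
      by (auto simp: B_def U_def sum_shift mult.commute)
  qed
  have "{y :: nat list. length y = Suc m \<and> (\<forall>i<Suc m. sum_list y \<le> k + y ! i)}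
      = A \<union> (\<Union>t\<in>{1..k div m}. B t)" (is "?S = ?R")
  proof (intro equalityI subsetI)
    fix y assume y: "y \<in> ?S"
    show "y \<in> ?R"
    proof (cases "sum_list y \<le> k")
      case True
      with y show ?thesis
        by (simp add: A_def)
    next
      case False
      define t where "t = sum_list y - k"
      define u where "u = map (\<lambda>x. x - t) y"
      have t: "1 \<le> t" "sum_list y = k + t"
        using False by (auto simp: t_def)
      have "t \<le> x" if "x \<in> set y" for x
        using y t that by (auto simp: in_set_conv_nth)
      then have yu: "y = map ((+) t) u"
        by (simp add: u_def map_idI)
      have u: "length u = Suc m"
        using y by (simp add: u_def)
      then have "k = m * t + sum_list u"
        using sum_shift[OF u, of t] t by (simp flip: yu)
      then have "u \<in> U t" "t \<in> {1..k div m}"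
        using u t m by (auto simp: U_def less_eq_div_iff_mult_less_eq mult.commute)
      then show ?thesis
        using yu by (auto simp: B_def)
    qed
  next
    fix y assume "y \<in> ?R"
    then consider "y \<in> A" | t where "t \<in> {1..k div m}" "y \<in> B t"
      by blast
    then show "y \<in> ?S"
    proof cases
      case 1
      then show ?thesis
        by (auto simp: A_def intro: trans_le_add1)
    next
      case 2
      with sum_B[OF 2(2,1)] show ?thesis
        by (auto simp: B_def U_def)
    qed
  qed
  moreover have "finite (U t)" for t
    by (rule finite_subset[OF _ card_lists_sum_le(1)[of m "k - m * t"]]) (auto simp: U_def)
  then have fin: "finite (B t)" for t
    by (simp add: B_def)
  moreover have "A \<inter> (\<Union>t\<in>{1..k div m}. B t) = {}"
    using sum_B by (fastforce simp: A_def)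
  moreover have "card (\<Union>t\<in>{1..k div m}. B t) = (\<Sum>t=1..k div m. card (B t))"
  proof (intro card_UN_disjoint ballI impI)
    show "B t \<inter> B j = {}" if "t \<in> {1..k div m}" "j \<in> {1..k div m}" "t \<noteq> j" for t j
      using sum_B[OF _ that(1)] sum_B[OF _ that(2)] that(3) by fastforce
  qed (use fin in simp_all)
  moreover have "card (B t) = (k - m * t + m choose m)" for t
  proof -
    have "card (B t) = card (U t)"
      unfolding B_def by (intro card_image) (simp add: inj_on_def inj_map_eq_map)
    also have "\<dots> = (k - m * t + m choose m)"
      unfolding U_def by (subst card_length_sum_list, subst binomial_symmetric) simp_all
    finally show ?thesis .
  qed
  ultimately show ?thesis
    using card_lists_sum_le[of m k]
    by (simp add: card_Un_disjoint step_binomial_sum_def flip: A_def)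
qed

section \<open>Scaling the polytope\<close>

lemma lookup_scaleR [simp]:
  "Poly_Mapping.lookup (c *\<^sub>R L) x = c * Poly_Mapping.lookup L x" for L :: "'b \<Rightarrow>\<^sub>0 real"
proof -
  have "finite {x. c *\<^sub>R Poly_Mapping.lookup L x \<noteq> 0}"
    by (rule finite_subset[OF _ finite_lookup[of L]]) auto
  then show ?thesis
    by (simp add: scaleR_poly_mapping_def)
qed

lemma vertex_sum_scaleR: "vertex_sum E (c *\<^sub>R L) v = c * vertex_sum E L v"
  by (simp add: vertex_sum_def sum_distrib_left)

lemma magic_coneI:
  assumes "Poly_Mapping.keys L \<subseteq> E" "\<And>e. e \<in> E \<Longrightarrow> 0 \<le> Poly_Mapping.lookup L e"
    and "\<And>v. v \<in> V \<Longrightarrow> vertex_sum E L v = c"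
  shows "L \<in> magic_cone V E"
  using assms unfolding magic_cone_def by simp

lemma magic_coneD:
  assumes "L \<in> magic_cone V E"
  shows "Poly_Mapping.keys L \<subseteq> E" "e \<in> E \<Longrightarrow> 0 \<le> Poly_Mapping.lookup L e"
    and "v \<in> V \<Longrightarrow> w \<in> V \<Longrightarrow> vertex_sum E L v = vertex_sum E L w"
  using assms unfolding magic_cone_def by blast+

lemma magic_cone_scaleR:
  assumes L: "L \<in> magic_cone V E" and c: "0 \<le> c"
  shows "c *\<^sub>R L \<in> magic_cone V E"
proof -
  have "Poly_Mapping.keys (c *\<^sub>R L) \<subseteq> Poly_Mapping.keys L"
    by (auto simp: in_keys_iff)
  then have "Poly_Mapping.keys (c *\<^sub>R L) \<subseteq> E"
    using magic_coneD(1)[OF L] by blast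
  moreover have "0 \<le> Poly_Mapping.lookup (c *\<^sub>R L) e" if "e \<in> E" for e
    using magic_coneD(2)[OF L that] c by simp
  \<comment> \<open>\<open>magic_coneI\<close> asks for a common value of the sums. An arbitrarily
    chosen vertex supplies it; for empty \<open>V\<close> the claim is vacuous.\<close>
  moreover have "vertex_sum E (c *\<^sub>R L) v = c * vertex_sum E L (SOME w. w \<in> V)" if "v \<in> V" for v
    using magic_coneD(3)[OF L that someI[of "\<lambda>w. w \<in> V", OF that]] by (simp add: vertex_sum_scaleR)
  ultimately show ?thesis
    by (rule magic_coneI)
qed

lemma zero_in_magic_cone: "0 \<in> magic_cone V E"
  by (rule magic_coneI[of _ _ _ 0]) (simp_all add: vertex_sum_def)

lemma scaled_magic_polytope:
  "(\<lambda>L. real k *\<^sub>R L) ` magic_polytope V E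
    = {L \<in> magic_cone V E. \<forall>e\<in>E. Poly_Mapping.lookup L e \<le> real k}" (is "?A = ?B")
proof (intro equalityI subsetI)
  fix L assume "L \<in> ?A"
  then show "L \<in> ?B"
    by (auto simp: magic_polytope_def magic_cone_scaleR mult_left_le)
next
  fix L assume L: "L \<in> ?B"
  show "L \<in> ?A"
  proof (cases "k = 0")
    \<comment> \<open>Division by \<open>k\<close> is impossible here. Instead, labels on
      \<open>E\<close> lie between 0 and 0, and labels off \<open>E\<close> vanish because the
      support lies in \<open>E\<close>.\<close>
    case True
    have "Poly_Mapping.lookup L e = 0" for e
    proof (cases "e \<in> E")
      case True
      with L \<open>k = 0\<close> magic_coneD(2)[of L V E e] show ?thesis
        by force
    next
      case False
      with L magic_coneD(1)[of L V E] show ?thesis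
        by (auto simp: in_keys_iff)
    qed
    then have "L = real k *\<^sub>R 0"
      by (intro poly_mapping_eqI) simp
    then show ?thesis
      by (rule image_eqI) (simp add: magic_polytope_def zero_in_magic_cone)
  next
    case False
    have "(1 / real k) *\<^sub>R L \<in> magic_cone V E"
      using L by (intro magic_cone_scaleR) auto
    moreover have "0 \<le> Poly_Mapping.lookup ((1 / real k) *\<^sub>R L) e"
      "Poly_Mapping.lookup ((1 / real k) *\<^sub>R L) e \<le> 1" if "e \<in> E" for e
      using L False that magic_coneD(2)[of L V E e] by auto
    ultimately have "(1 / real k) *\<^sub>R L \<in> magic_polytope V E"
      by (auto simp: magic_polytope_def)
    then show ?thesis
      by (rule rev_image_eqI) (use False in simp)
  qed
qed

section \<open>Two hubs joined by paths of length three\<close>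

text \<open>The hubs are 0 and 1; the inner vertices of the $i$-th path are $2i+2$ and $2i+3$.\<close>

definition left_edge :: "nat \<Rightarrow> nat set" where "left_edge i = {0, 2 * i + 2}"
definition mid_edge :: "nat \<Rightarrow> nat set" where "mid_edge i = {2 * i + 2, 2 * i + 3}"
definition right_edge :: "nat \<Rightarrow> nat set" where "right_edge i = {1, 2 * i + 3}"

definition theta_vertices :: "nat \<Rightarrow> nat set" where "theta_vertices n = {..<2 * n + 2}"
definition theta_edges :: "nat \<Rightarrow> nat set set" where
  "theta_edges n = left_edge ` {..<n} \<union> mid_edge ` {..<n} \<union> right_edge ` {..<n}"

text \<open>Only left edges contain hub 0 and only right edges contain hub 1; the inner endpoints
  determine the index.\<close>

lemma theta_edge_eq_iff [simp]:
  "left_edge i = left_edge j \<longleftrightarrow> i = j"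
  "mid_edge i = mid_edge j \<longleftrightarrow> i = j"
  "right_edge i = right_edge j \<longleftrightarrow> i = j"
  "left_edge i \<noteq> mid_edge j" "mid_edge i \<noteq> left_edge j"
  "left_edge i \<noteq> right_edge j" "right_edge i \<noteq> left_edge j"
  "mid_edge i \<noteq> right_edge j" "right_edge i \<noteq> mid_edge j"
  unfolding left_edge_def mid_edge_def right_edge_def doubleton_eq_iff by presburger+

lemma mem_theta_edge_iff:
  "v \<in> left_edge i \<longleftrightarrow> v = 0 \<or> v = 2 * i + 2"
  "v \<in> mid_edge i \<longleftrightarrow> v = 2 * i + 2 \<or> v = 2 * i + 3"
  "v \<in> right_edge i \<longleftrightarrow> v = 1 \<or> v = 2 * i + 3"
  by (auto simp: left_edge_def mid_edge_def right_edge_def)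

lemma theta_vertices_cases:
  assumes "v \<in> theta_vertices n"
  obtains "v = 0" | "v = 1" | i where "i < n" "v = 2 * i + 2" | i where "i < n" "v = 2 * i + 3"
proof -
  have "v = 0 \<or> v = 1 \<or> (\<exists>i<n. v = 2 * i + 2) \<or> (\<exists>i<n. v = 2 * i + 3)"
    using assms unfolding theta_vertices_def lessThan_iff by presburger
  with that show ?thesis
    by blast
qed

section \<open>Size and vertex sums of the graph\<close>

lemma graph_theta: "graph (theta_vertices n) (theta_edges n)"
  by (auto simp: graph_def theta_vertices_def theta_edges_def left_edge_def mid_edge_def right_edge_def)

lemma card_theta_edges: "card (theta_edges n) = 3 * n"
  unfolding theta_edges_def
  by (subst card_Un_disjoint; (subst card_Un_disjoint)?) (auto simp: card_image inj_on_def)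

lemma vertex_sum_theta:
  "vertex_sum (theta_edges n) L 0 = (\<Sum>i<n. Poly_Mapping.lookup L (left_edge i))"
  "vertex_sum (theta_edges n) L 1 = (\<Sum>i<n. Poly_Mapping.lookup L (right_edge i))"
  "i < n \<Longrightarrow> vertex_sum (theta_edges n) L (2 * i + 2)
     = Poly_Mapping.lookup L (left_edge i) + Poly_Mapping.lookup L (mid_edge i)"
  "i < n \<Longrightarrow> vertex_sum (theta_edges n) L (2 * i + 3)
     = Poly_Mapping.lookup L (mid_edge i) + Poly_Mapping.lookup L (right_edge i)"
proof -
  have "{e \<in> theta_edges n. 0 \<in> e} = left_edge ` {..<n}"
    by (auto simp: theta_edges_def mem_theta_edge_iff)
  then show "vertex_sum (theta_edges n) L 0 = (\<Sum>i<n. Poly_Mapping.lookup L (left_edge i))"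
    by (simp add: vertex_sum_def sum.reindex inj_on_def)
  have "{e \<in> theta_edges n. 1 \<in> e} = right_edge ` {..<n}"
    by (auto simp: theta_edges_def mem_theta_edge_iff)
  then show "vertex_sum (theta_edges n) L 1 = (\<Sum>i<n. Poly_Mapping.lookup L (right_edge i))"
    by (simp add: vertex_sum_def sum.reindex inj_on_def)
next
  assume i: "i < n"
  have "{e \<in> theta_edges n. 2 * i + 2 \<in> e} = {left_edge i, mid_edge i}"
    using i by (auto simp: theta_edges_def mem_theta_edge_iff; presburger)
  then show "vertex_sum (theta_edges n) L (2 * i + 2)
     = Poly_Mapping.lookup L (left_edge i) + Poly_Mapping.lookup L (mid_edge i)"
    by (simp add: vertex_sum_def)
  have "{e \<in> theta_edges n. 2 * i + 3 \<in> e} = {mid_edge i, right_edge i}"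
    using i by (auto simp: theta_edges_def mem_theta_edge_iff; presburger)
  then show "vertex_sum (theta_edges n) L (2 * i + 3)
     = Poly_Mapping.lookup L (mid_edge i) + Poly_Mapping.lookup L (right_edge i)"
    by (simp add: vertex_sum_def)
qed

section \<open>Magic labelings in terms of the labels at the first hub\<close>

definition theta_labeling :: "nat \<Rightarrow> (nat \<Rightarrow> real) \<Rightarrow> nat labeling" where
  "theta_labeling n y = (\<Sum>i<n. Poly_Mapping.single (left_edge i) (y i)
     + Poly_Mapping.single (mid_edge i) (sum y {..<n} - y i)
     + Poly_Mapping.single (right_edge i) (y i))"

lemma theta_labeling_cong:
  assumes "\<And>i. i < n \<Longrightarrow> y i = z i"
  shows "theta_labeling n y = theta_labeling n z"
proof -
  have "sum y {..<n} = sum z {..<n}"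
    using assms by (intro sum.cong) auto
  then show ?thesis
    unfolding theta_labeling_def using assms by (intro sum.cong) auto
qed

lemma lookup_theta_labeling [simp]:
  "i < n \<Longrightarrow> Poly_Mapping.lookup (theta_labeling n y) (left_edge i) = y i"
  "i < n \<Longrightarrow> Poly_Mapping.lookup (theta_labeling n y) (mid_edge i) = sum y {..<n} - y i"
  "i < n \<Longrightarrow> Poly_Mapping.lookup (theta_labeling n y) (right_edge i) = y i"
  "e \<notin> theta_edges n \<Longrightarrow> Poly_Mapping.lookup (theta_labeling n y) e = 0"
  by (auto simp: theta_labeling_def lookup_sum lookup_add lookup_single when_def theta_edges_def
      intro!: sum.neutral)

lemma ball_theta_edges:
  "(\<forall>e\<in>theta_edges n. P e) \<longleftrightarrow> (\<forall>i<n. P (left_edge i) \<and> P (mid_edge i) \<and> P (right_edge i))"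
  by (auto simp: theta_edges_def)

lemma theta_labeling_eqI:
  assumes "Poly_Mapping.keys L \<subseteq> theta_edges n"
    and "\<And>i. i < n \<Longrightarrow> Poly_Mapping.lookup L (left_edge i) = y i"
    and "\<And>i. i < n \<Longrightarrow> Poly_Mapping.lookup L (mid_edge i) = sum y {..<n} - y i"
    and "\<And>i. i < n \<Longrightarrow> Poly_Mapping.lookup L (right_edge i) = y i"
  shows "L = theta_labeling n y"
proof (rule poly_mapping_eqI)
  fix e
  have "\<forall>e\<in>theta_edges n. Poly_Mapping.lookup L e = Poly_Mapping.lookup (theta_labeling n y) e"
    unfolding ball_theta_edges by (simp add: assms)
  moreover have "Poly_Mapping.lookup L e = Poly_Mapping.lookup (theta_labeling n y) e"
    if "e \<notin> theta_edges n"
    using that assms(1) by (auto simp: in_keys_iff)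
  ultimately show "Poly_Mapping.lookup L e = Poly_Mapping.lookup (theta_labeling n y) e"
    by blast
qed

text \<open>Let \<open>s\<close> be the sum at hub 0. The vertex \<open>2 * i + 2\<close> forces the
  middle label \<open>s - y i\<close>, and then \<open>2 * i + 3\<close> forces the right label
  \<open>y i\<close>. Conversely such a labeling has sum \<open>s\<close> at every vertex, and its
  middle labels are nonnegative because \<open>y i\<close> is one summand of
  \<open>s\<close>.\<close>

lemma magic_cone_theta:
  "magic_cone (theta_vertices n) (theta_edges n) = theta_labeling n ` {y. \<forall>i<n. 0 \<le> y i}"
proof (intro equalityI subsetI)
  fix L assume L: "L \<in> magic_cone (theta_vertices n) (theta_edges n)"
  define y where "y i = Poly_Mapping.lookup L (left_edge i)" for i
  have eq: "vertex_sum (theta_edges n) L v = sum y {..<n}" if "v < 2 * n + 2" for v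
    using magic_coneD(3)[OF L, of v 0] that by (simp add: theta_vertices_def vertex_sum_theta(1) y_def)
  have "L = theta_labeling n y"
  proof (rule theta_labeling_eqI)
    fix i assume i: "i < n"
    then show "Poly_Mapping.lookup L (mid_edge i) = sum y {..<n} - y i"
      using eq[of "2 * i + 2"] vertex_sum_theta(3)[OF i, of L] by (simp add: y_def)
    then show "Poly_Mapping.lookup L (right_edge i) = y i"
      using i eq[of "2 * i + 3"] vertex_sum_theta(4)[OF i, of L] by simp
  qed (use magic_coneD(1)[OF L] in \<open>auto simp: y_def\<close>)
  moreover have "\<forall>i<n. 0 \<le> y i"
    using magic_coneD(2)[OF L] by (auto simp: y_def theta_edges_def)
  ultimately show "L \<in> theta_labeling n ` {y. \<forall>i<n. 0 \<le> y i}"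
    by blast
next
  fix L assume "L \<in> theta_labeling n ` {y. \<forall>i<n. 0 \<le> y i}"
  then obtain y where L: "L = theta_labeling n y" and y: "\<And>i. i < n \<Longrightarrow> 0 \<le> y i"
    by blast
  have "vertex_sum (theta_edges n) L v = sum y {..<n}" if "v \<in> theta_vertices n" for v
    using that by (cases rule: theta_vertices_cases) (simp_all only: vertex_sum_theta, simp_all add: L)
  moreover have "y i \<le> sum y {..<n}" if "i < n" for i
    using that y by (intro member_le_sum) auto
  moreover have "Poly_Mapping.keys L \<subseteq> theta_edges n"
    unfolding L by (metis in_keys_iff lookup_theta_labeling(4) subsetI)
  moreover have "\<forall>e\<in>theta_edges n. 0 \<le> Poly_Mapping.lookup L e"
    unfolding ball_theta_edges L using y \<open>\<And>i. i < n \<Longrightarrow> y i \<le> sum y {..<n}\<close> by simp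
  ultimately show "L \<in> magic_cone (theta_vertices n) (theta_edges n)"
    by (intro magic_coneI) blast+
qed

text \<open>The bounds on the middle edges imply those on the outer ones: for some \<open>j\<close>
  other than \<open>i\<close>, which exists as \<open>n \<ge> 2\<close>, nonnegativity gives
  \<open>y i \<le> s - y j \<le> c\<close>, where \<open>s\<close> is the sum of
  \<open>y\<close>.\<close>

lemma theta_labeling_bounded_iff:
  assumes n: "2 \<le> n" and y: "\<And>i. i < n \<Longrightarrow> 0 \<le> y i"
  shows "(\<forall>e\<in>theta_edges n. Poly_Mapping.lookup (theta_labeling n y) e \<le> c)
    \<longleftrightarrow> (\<forall>i<n. sum y {..<n} \<le> c + y i)"
proof -
  have "y i \<le> c" if c: "\<forall>i<n. sum y {..<n} \<le> c + y i" and i: "i < n" for i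
  proof -
    define j :: nat where "j = (if i = 0 then 1 else 0)"
    have j: "j < n" "j \<noteq> i"
      using n by (auto simp: j_def)
    have "y i \<le> sum y ({..<n} - {j})"
      using i j y by (intro member_le_sum) auto
    also have "\<dots> = sum y {..<n} - y j"
      using j by (subst sum_diff) auto
    finally show ?thesis
      using c j by force
  qed
  then show ?thesis
    by (auto simp: ball_theta_edges algebra_simps)
qed

text \<open>Functions that agree below \<open>n\<close> give the same labeling, so lists of length
  \<open>n\<close> serve as unique representatives; the labels of the left edges recover the
  list.\<close>

lemma magic_count_theta:
  assumes n: "2 \<le> n"
  shows "magic_count (theta_vertices n) (theta_edges n) k
    = card {y :: nat list. length y = n \<and> (\<forall>i<n. sum_list y \<le> k + y ! i)}" (is "_ = card ?Y")
proof -
  define f where "f y = theta_labeling n (\<lambda>i. real (y ! i))" for y :: "nat list"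
  have sum_nth: "(\<Sum>i<n. real (y ! i)) = real (sum_list y)" if "length y = n" for y :: "nat list"
    using that by (simp add: sum_list_sum_nth atLeast0LessThan)
  have bounded: "(\<forall>e\<in>theta_edges n. Poly_Mapping.lookup (f y) e \<le> real k)
      \<longleftrightarrow> (\<forall>i<n. sum_list y \<le> k + y ! i)" if "length y = n" for y
    unfolding f_def using that
    by (subst theta_labeling_bounded_iff[OF n])
       (simp_all add: sum_nth flip: of_nat_add)
  have "inj_on f ?Y"
  proof (rule inj_onI)
    fix y z assume yz: "y \<in> ?Y" "z \<in> ?Y" "f y = f z"
    then have "real (y ! i) = real (z ! i)" if "i < n" for i
      using lookup_theta_labeling(1)[OF that] by (metis f_def)
    with yz show "y = z"
      by (simp add: list_eq_iff_nth_eq)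
  qed
  moreover have "f ` ?Y = {L \<in> (\<lambda>L. real k *\<^sub>R L) ` magic_polytope (theta_vertices n) (theta_edges n).
      integral_point L}" (is "_ = ?L")
  proof (intro equalityI subsetI)
    fix L assume "L \<in> f ` ?Y"
    then obtain y where y: "y \<in> ?Y" and L: "L = f y"
      by blast
    have "\<forall>e\<in>theta_edges n. Poly_Mapping.lookup L e \<in> \<int>"
      unfolding ball_theta_edges L f_def using y by (simp add: sum_nth)
    moreover have "Poly_Mapping.lookup L e \<in> \<int>" if "e \<notin> theta_edges n" for e
      using that by (simp add: L f_def)
    ultimately have "integral_point L"
      unfolding integral_point_def by blast
    moreover have "L \<in> magic_cone (theta_vertices n) (theta_edges n)"
      unfolding magic_cone_theta L f_def by auto
    ultimately show "L \<in> ?L"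
      using bounded[of y] y by (simp add: scaled_magic_polytope L)
  next
    fix L assume L: "L \<in> ?L"
    then obtain y where y: "\<And>i. i < n \<Longrightarrow> 0 \<le> y i" and Ly: "L = theta_labeling n y"
      by (auto simp: scaled_magic_polytope magic_cone_theta)
    \<comment> \<open>Each \<open>y i\<close> is the label of a left edge, hence a nonnegative
      integer, and rounding only changes its type.\<close>
    define z where "z = map (\<lambda>i. nat \<lfloor>y i\<rfloor>) [0..<n]"
    have z: "real (z ! i) = y i" if "i < n" for i
    proof -
      have "integral_point L"
        using L by blast
      then have "y i \<in> \<int>"
        using lookup_theta_labeling(1)[OF that, of y] unfolding Ly integral_point_def by metis
      then show ?thesis
        using y[OF that] that by (auto simp: z_def elim!: Ints_cases)
    qed
    have "L = f z"
      unfolding Ly f_def by (intro theta_labeling_cong) (simp add: z)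
    moreover have "length z = n"
      by (simp add: z_def)
    ultimately show "L \<in> f ` ?Y"
      using L bounded[of z] by (auto simp: scaled_magic_polytope)
  qed
  ultimately show ?thesis
    unfolding magic_count_def using card_image[of f ?Y] by (simp only:)
qed

section \<open>The polytope and its vertex with denominator \<open>m\<close>\<close>

lemma magic_polytope_theta:
  assumes "2 \<le> n"
  shows "magic_polytope (theta_vertices n) (theta_edges n)
    = theta_labeling n ` {y. \<forall>i<n. 0 \<le> y i \<and> sum y {..<n} \<le> 1 + y i}"
proof -
  have "magic_polytope (theta_vertices n) (theta_edges n)
      = {L \<in> theta_labeling n ` {y. \<forall>i<n. 0 \<le> y i}.
          \<forall>e\<in>theta_edges n. Poly_Mapping.lookup L e \<le> 1}"
    using scaled_magic_polytope[of 1 "theta_vertices n" "theta_edges n"] by (simp add: magic_cone_theta)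
  also have "\<dots> = theta_labeling n ` {y. (\<forall>i<n. 0 \<le> y i) \<and>
      (\<forall>e\<in>theta_edges n. Poly_Mapping.lookup (theta_labeling n y) e \<le> 1)}"
    by blast
  also have "{y. (\<forall>i<n. 0 \<le> y i) \<and>
        (\<forall>e\<in>theta_edges n. Poly_Mapping.lookup (theta_labeling n y) e \<le> 1)}
      = {y. \<forall>i<n. 0 \<le> y i \<and> sum y {..<n} \<le> 1 + y i}"
    using theta_labeling_bounded_iff[OF assms] by blast
  finally show ?thesis .
qed

text \<open>The points of the polytope whose middle labels all attain the upper bound 1 form a face,
  and \<open>v\<close> is its only point: \<open>y i = s - 1\<close> for every \<open>i\<close>
  gives \<open>s = (m + 1) * (s - 1)\<close>, so each \<open>y i\<close> is
  \<open>1 / m\<close>.\<close>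

lemma theta_vertex_extreme:
  fixes m :: nat
  assumes m: "1 \<le> m"
  defines "v \<equiv> theta_labeling (Suc m) (\<lambda>_. 1 / real m)"
  shows "v extreme_point_of magic_polytope (theta_vertices (Suc m)) (theta_edges (Suc m))"
    (is "_ extreme_point_of ?P")
proof -
  have P: "?P = theta_labeling (Suc m) ` {y. \<forall>i<Suc m. 0 \<le> y i \<and> sum y {..<Suc m} \<le> 1 + y i}"
    using m by (intro magic_polytope_theta) simp
  have mid_v: "Poly_Mapping.lookup v (mid_edge i) = 1" if "i < Suc m" for i
    using that m by (simp add: v_def field_simps)
  have unique: "a = v" if a: "a \<in> ?P"
    and mid: "\<And>i. i < Suc m \<Longrightarrow> Poly_Mapping.lookup a (mid_edge i) = 1" for a
  proof -
    obtain y where y: "a = theta_labeling (Suc m) y"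
      using a P by blast
    define s where "s = sum y {..<Suc m}"
    have ys: "y i = s - 1" if "i < Suc m" for i
      using mid[OF that] that by (simp add: y s_def)
    have "sum y {..<Suc m} = (\<Sum>i<Suc m. s - 1)"
      using ys by (intro sum.cong) auto
    then have "s = (real m + 1) * (s - 1)"
      unfolding s_def[symmetric] by (simp add: add.commute)
    then have "s - 1 = 1 / real m"
      using m by (simp add: field_simps)
    with ys show ?thesis
      unfolding y v_def by (intro theta_labeling_cong) simp
  qed
  have "v \<in> ?P"
    unfolding P v_def using m by (intro imageI) (simp add: field_simps)
  moreover have "v \<notin> open_segment a b" if ab: "a \<in> ?P" "b \<in> ?P" for a b
  proof
    assume "v \<in> open_segment a b"
    then obtain u where u: "a \<noteq> b" "0 < u" "u < 1" "v = (1 - u) *\<^sub>R a + u *\<^sub>R b"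
      by (auto simp: in_segment)
    have "Poly_Mapping.lookup a (mid_edge i) = 1 \<and> Poly_Mapping.lookup b (mid_edge i) = 1"
      if i: "i < Suc m" for i
    proof -
      let ?x = "Poly_Mapping.lookup a (mid_edge i)" and ?y = "Poly_Mapping.lookup b (mid_edge i)"
      have le: "?x \<le> 1" "?y \<le> 1"
        using ab i by (auto simp: magic_polytope_def ball_theta_edges)
      \<comment> \<open>The label 1 of \<open>v\<close> is a proper convex combination of two labels
        that are at most 1, so both slacks must vanish.\<close>
      have "(1 - u) * (1 - ?x) + u * (1 - ?y) = 0"
        using mid_v[OF i] unfolding u(4) lookup_add lookup_scaleR by (simp add: algebra_simps)
      moreover have "0 \<le> (1 - u) * (1 - ?x)" "0 \<le> u * (1 - ?y)"
        using u le by simp_all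
      ultimately have "(1 - u) * (1 - ?x) = 0" "u * (1 - ?y) = 0"
        by linarith+
      with u show ?thesis
        by simp
    qed
    then have "a = v" "b = v"
      using unique ab by blast+
    with u(1) show False
      by simp
  qed
  ultimately show ?thesis
    by (simp add: extreme_point_of_def)
qed

lemma denominator_theta_vertex:
  fixes m :: nat
  assumes m: "1 \<le> m"
  defines "v \<equiv> theta_labeling (Suc m) (\<lambda>_. 1 / real m)"
  shows "rational_point v" "denominator v = m"
proof -
  have "\<forall>e\<in>theta_edges (Suc m). Poly_Mapping.lookup v e \<in> {1 / real m, 1}"
    unfolding ball_theta_edges v_def using m by (simp add: field_simps)
  then have v: "Poly_Mapping.lookup v e \<in> {0, 1 / real m, 1}" for e
    by (cases "e \<in> theta_edges (Suc m)") (auto simp: v_def)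
  have "Poly_Mapping.lookup v e \<in> \<rat>" for e
    using v[of e] by auto
  then show "rational_point v"
    by (simp add: rational_point_def)
  have "Poly_Mapping.lookup (real m *\<^sub>R v) e \<in> \<int>" for e
    using v[of e] m by auto
  then have "integral_point (real m *\<^sub>R v)"
    by (simp add: integral_point_def)
  moreover have "m \<le> t" if "1 \<le> t" "integral_point (real t *\<^sub>R v)" for t
  proof -
    \<comment> \<open>The left edge of path 0 carries \<open>1 / m\<close>. Integrality makes
      \<open>t / m\<close> a positive integer, so \<open>t \<ge> m\<close>.\<close>
    have "real t * (1 / real m) \<in> \<int>"
      using that(2) unfolding integral_point_def v_def
      by (metis lookup_scaleR lookup_theta_labeling(1) zero_less_Suc)
    then obtain z where z: "real t / real m = of_int z"
      by (auto elim: Ints_cases)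
    moreover have "0 < real t / real m"
      using that(1) m by simp
    ultimately have "1 \<le> real t / real m"
      by simp
    with m show ?thesis
      by simp
  qed
  ultimately show "denominator v = m"
    unfolding denominator_def using m by (intro Least_equality) auto
qed

lemma theta_min_quasiperiod:
  fixes n :: nat
  defines "F \<equiv> \<lambda>k. of_nat (magic_count (theta_vertices n) (theta_edges n) k)"
  assumes n: "2 \<le> n"
  shows "quasipolynomial F" "min_quasiperiod F = n - 1"
proof -
  obtain m where m: "n = Suc m" "1 \<le> m"
    using n by (cases n) auto
  have F: "F = (\<lambda>k. of_nat ((k + Suc m choose Suc m) + step_binomial_sum m m k))"
    using n m by (simp only: F_def magic_count_theta card_lists_sum_le_add_nth)
  show "quasipolynomial F" "min_quasiperiod F = n - 1"
    unfolding F quasipolynomial_def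
    using quasiperiod_binomial_plus_step_binomial_sum[OF m(2), of m] m by (blast, simp)
qed

theorem theorem2p6:
  shows "(\<forall>N::nat. \<exists>(V::nat set) E. graph V E \<and>
            quasipolynomial (\<lambda>k. of_nat (magic_count V E k)) \<and>
            N \<le> min_quasiperiod (\<lambda>k. of_nat (magic_count V E k))) \<and>
         (\<forall>n::nat. 2 \<le> n \<longrightarrow> (\<exists>(V::nat set) E. graph V E \<and> card V = 2 * n + 2 \<and> card E = 3 * n \<and>
            (\<exists>v. v extreme_point_of magic_polytope V E \<and> rational_point v \<and> denominator v = n - 1) \<and>
            quasipolynomial (\<lambda>k. of_nat (magic_count V E k)) \<and>
            min_quasiperiod (\<lambda>k. of_nat (magic_count V E k)) = n - 1))"
proof (intro conjI allI impI)
  \<comment> \<open>The graph with \<open>n = N + 2\<close> has minimum quasiperiod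
    \<open>N + 1\<close>.\<close>
  fix N :: nat
  show "\<exists>(V::nat set) E. graph V E \<and>
            quasipolynomial (\<lambda>k. of_nat (magic_count V E k)) \<and>
            N \<le> min_quasiperiod (\<lambda>k. of_nat (magic_count V E k))"
    using graph_theta[of "N + 2"] theta_min_quasiperiod[of "N + 2"]
    by (intro exI[of _ "theta_vertices (N + 2)"] exI[of _ "theta_edges (N + 2)"]) simp
next
  fix n :: nat assume n: "2 \<le> n"
  then obtain m where m: "n = Suc m" "1 \<le> m"
    by (cases n) auto
  have "\<exists>v. v extreme_point_of magic_polytope (theta_vertices n) (theta_edges n)
      \<and> rational_point v \<and> denominator v = n - 1"
    using theta_vertex_extreme[OF m(2)] denominator_theta_vertex[OF m(2)] m(1) by auto
  then show "\<exists>(V::nat set) E. graph V E \<and> card V = 2 * n + 2 \<and> card E = 3 * n \<and>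
            (\<exists>v. v extreme_point_of magic_polytope V E \<and> rational_point v \<and> denominator v = n - 1) \<and>
            quasipolynomial (\<lambda>k. of_nat (magic_count V E k)) \<and>
            min_quasiperiod (\<lambda>k. of_nat (magic_count V E k)) = n - 1"
    using graph_theta[of n] card_theta_edges[of n] theta_min_quasiperiod[OF n]
    by (intro exI[of _ "theta_vertices n"] exI[of _ "theta_edges n"])
       (simp add: theta_vertices_def)
qed

end
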